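(* Let $\mathcal{X}\in\mathbb{R}^{I_1\times\cdots\times I_M\times n}$ be a data tensor, let $W=(w_{i,j})\in\mathbb{R}^{n\times n}$ be a symmetric weight matrix with Laplacian $L=D-W$, where $D$ is the diagonal matrix with $D_{ii}=\sum_j w_{i,j}$, and let $1\le d\le I_1\cdots I_M$. Consider the problem of minimizing $$\Phi_{OLPP}(\mathcal{Y})=\frac12\sum_{i,j=1}^n w_{i,j}\big\|\mathcal{Y}^{(i)}-\mathcal{Y}^{(j)}\big\|_F^2,\qquad \mathcal{Y}=\mathcal{P}^\top *_M\mathcal{X}\in\mathbb{R}^{d\times n},$$ over all $\mathcal{P}\in\mathbb{R}^{I_1\times\cdots\times I_M\times d}$ with $\mathcal{P}^\top *_M\mathcal{P}=\mathcal{I}$. A solution is given by the tensor $\mathcal{P}$ whose $d$ frontal slices are the smallest $d$ eigen-tensors (taken orthonormal) of the symmetric tensor $(\mathcal{X}\times_{M+1}L)*_1\mathcal{X}^\top\in\mathbb{R}^{I_1\times\cdots\times I_M\times I_1\times\cdots\times I_M}$.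
   Context: The frontal slice $\mathcal{A}^{(i)}$ of a tensor is obtained by fixing its last index to $i$. The Einstein product $*_N$ contracts the last $N$ modes of the first tensor with the first $N$ modes of the second: $(\mathcal{A}*_N\mathcal{B})_{i_1\ldots i_p j_1\ldots j_q}=\sum_{k_1,\ldots,k_N}\mathcal{A}_{i_1\ldots i_pk_1\ldots k_N}\mathcal{B}_{k_1\ldots k_Nj_1\ldots j_q}$. For $\mathcal{A}\in\mathbb{R}^{I_1\times\cdots\times I_M\times K}$, the transpose $\mathcal{A}^\top\in\mathbb{R}^{K\times I_1\times\cdots\times I_M}$ has entries $(\mathcal{A}^\top)_{k i_1\ldots i_M}=\mathcal{A}_{i_1\ldots i_M k}$ (this applies to $\mathcal{P}$ with $K=d$ and $\mathcal{X}$ with $K=n$). $\mathcal{I}$ denotes the identity tensor (here the $d\times d$ identity matrix). $\|\cdot\|_F$ is the Frobenius norm, with associated inner product the sum of entrywise products (used for "orthonormal"). The $m$-mode product of $\mathcal{A}$ with a matrix $U$ is $(\mathcal{A}\times_mU)_{i_1\ldots i_{m-1}ji_{m+1}\ldots}=\sum_{i_m}U_{ji_m}\mathcal{A}_{i_1\ldots i_m\ldots}$. An eigen-tensor of $\mathcal{A}\in\mathbb{R}^{I_1\times\cdots\times I_M\times I_1\times\cdots\times I_M}$ with eigenvalue $\lambda\in\mathbb{R}$ is a nonzero $\mathcal{Z}\in\mathbb{R}^{I_1\times\cdots\times I_M}$ with $\mathcal{A}*_M\mathcal{Z}=\lambda\mathcal{Z}$; the smallest $d$ eigen-tensors are those associated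 with the $d$ smallest eigenvalues, counted with multiplicity. *)

theory Defs
  imports Complex_Main "HOL-Library.Multiset" "Jordan_Normal_Form.Matrix"
begin

section \<open>Real tensors\<close>

text \<open>Multi-indices are lists of 0-based indices: mode \<open>k\<close> of extent \<open>ds ! k\<close> is indexed by
  \<open>0, \<dots>, ds ! k - 1\<close>.\<close>

definition tensor_idx :: "nat list \<Rightarrow> nat list set" where
  "tensor_idx ds = {is. list_all2 (<) is ds}"

text \<open>A tensor is its list of extents together with its entries. Entries outside the index range
  are 0, so that equality of tensors is equality of shape and of in-range entries.\<close>

typedef tensor = "{(ds :: nat list, f :: nat list \<Rightarrow> real). \<forall>is. is \<notin> tensor_idx ds \<longrightarrow> f is = 0}"
  by auto

setup_lifting type_definition_tensor

lift_definition shape :: "tensor \<Rightarrow> nat list" is fst .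

lift_definition entry :: "tensor \<Rightarrow> nat list \<Rightarrow> real" (infixl "$\<^sub>t" 100) is snd .

lift_definition mk_tensor :: "nat list \<Rightarrow> (nat list \<Rightarrow> real) \<Rightarrow> tensor"
  is "\<lambda>ds f. (ds, \<lambda>is. if is \<in> tensor_idx ds then f is else 0)"
  by auto

lemma shape_mk_tensor [simp]: "shape (mk_tensor ds f) = ds"
  by transfer simp

lemma entry_mk_tensor: "mk_tensor ds f $\<^sub>t is = (if is \<in> tensor_idx ds then f is else 0)"
  by transfer simp

lemma entry_outside: "is \<notin> tensor_idx (shape A) \<Longrightarrow> A $\<^sub>t is = 0"
  by transfer auto

lemma tensor_eqI:
  assumes "shape A = shape B" and "\<And>is. is \<in> tensor_idx (shape A) \<Longrightarrow> A $\<^sub>t is = B $\<^sub>t is"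
  shows "A = B"
  using assms by transfer force

definition tensor_space :: "nat list \<Rightarrow> tensor set" where
  "tensor_space ds = {A. shape A = ds}"

definition tensor_order :: "tensor \<Rightarrow> nat" where
  "tensor_order A = length (shape A)"

definition zero_tensor :: "nat list \<Rightarrow> tensor" where
  "zero_tensor ds = mk_tensor ds (\<lambda>_. 0)"

definition id_tensor :: "nat \<Rightarrow> tensor" where
  "id_tensor d = mk_tensor [d, d] (\<lambda>is. if is ! 0 = is ! 1 then 1 else 0)"

text \<open>Difference is meaningful for tensors of equal shape only.\<close>

instantiation tensor :: minus
begin
definition minus_tensor :: "tensor \<Rightarrow> tensor \<Rightarrow> tensor" where
  "A - B = mk_tensor (shape A) (\<lambda>is. A $\<^sub>t is - B $\<^sub>t is)"
instance ..
end

definition tensor_scale :: "real \<Rightarrow> tensor \<Rightarrow> tensor" (infixr "\<cdot>\<^sub>t" 75) where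
  "c \<cdot>\<^sub>t A = mk_tensor (shape A) (\<lambda>is. c * A $\<^sub>t is)"

definition tensor_inner :: "tensor \<Rightarrow> tensor \<Rightarrow> real" where
  "tensor_inner A B = (\<Sum>is\<in>tensor_idx (shape A). A $\<^sub>t is * B $\<^sub>t is)"

definition frob_norm :: "tensor \<Rightarrow> real" where
  "frob_norm A = sqrt (tensor_inner A A)"

definition frontal_slice :: "tensor \<Rightarrow> nat \<Rightarrow> tensor" where
  "frontal_slice A i = mk_tensor (butlast (shape A)) (\<lambda>is. A $\<^sub>t (is @ [i]))"

definition frontal_slices :: "tensor \<Rightarrow> tensor list" where
  "frontal_slices A = map (frontal_slice A) [0..<last (shape A)]"

definition tensor_transpose :: "tensor \<Rightarrow> tensor" where
  "tensor_transpose A =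
     mk_tensor (last (shape A) # butlast (shape A)) (\<lambda>is. A $\<^sub>t (tl is @ [hd is]))"

text \<open>The last \<open>N\<close> extents of \<open>A\<close> are expected to be the first \<open>N\<close> extents of \<open>B\<close>.\<close>

definition einstein :: "tensor \<Rightarrow> nat \<Rightarrow> tensor \<Rightarrow> tensor"
    ("(_ \<star>\<^bsub>_\<^esub> _)" [70, 0, 71] 70) where
  "A \<star>\<^bsub>N\<^esub> B =
     (let p = tensor_order A - N in
      mk_tensor (take p (shape A) @ drop N (shape B))
        (\<lambda>is. \<Sum>ks\<in>tensor_idx (take N (shape B)). A $\<^sub>t (take p is @ ks) * B $\<^sub>t (ks @ drop p is)))"

text \<open>Modes are numbered from 1.\<close>

definition mode_product :: "tensor \<Rightarrow> nat \<Rightarrow> real mat \<Rightarrow> tensor"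
    ("(_ \<times>\<^bsub>_\<^esub> _)" [70, 0, 71] 70) where
  "A \<times>\<^bsub>m\<^esub> U =
     mk_tensor ((shape A)[m - 1 := dim_row U])
       (\<lambda>is. \<Sum>k<shape A ! (m - 1). U $$ (is ! (m - 1), k) * A $\<^sub>t (is[m - 1 := k]))"

definition symmetric_tensor :: "tensor \<Rightarrow> bool" where
  "symmetric_tensor A \<longleftrightarrow>
     (\<exists>ds. shape A = ds @ ds \<and>
       (\<forall>is\<in>tensor_idx ds. \<forall>js\<in>tensor_idx ds. A $\<^sub>t (is @ js) = A $\<^sub>t (js @ is)))"

section \<open>Eigen-tensors\<close>

definition eigen_tensor :: "tensor \<Rightarrow> real \<Rightarrow> tensor \<Rightarrow> bool" where
  "eigen_tensor A lam Z \<longleftrightarrow>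
     shape A = shape Z @ shape Z \<and> Z \<noteq> zero_tensor (shape Z) \<and>
     A \<star>\<^bsub>tensor_order Z\<^esub> Z = lam \<cdot>\<^sub>t Z"

definition lin_indep_tensors :: "tensor list \<Rightarrow> bool" where
  "lin_indep_tensors Zs \<longleftrightarrow>
     (\<forall>c :: nat \<Rightarrow> real. (\<forall>is. (\<Sum>k<length Zs. c k * (Zs ! k) $\<^sub>t is) = 0)
        \<longrightarrow> (\<forall>k<length Zs. c k = 0))"

definition orthonormal_tensors :: "tensor list \<Rightarrow> bool" where
  "orthonormal_tensors Zs \<longleftrightarrow>
     (\<forall>i<length Zs. \<forall>j<length Zs. tensor_inner (Zs ! i) (Zs ! j) = (if i = j then 1 else 0))"

text \<open>The dimension of the eigenspace; it is 0 iff \<open>lam\<close> is not an eigenvalue.\<close>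

definition eigen_multiplicity :: "tensor \<Rightarrow> real \<Rightarrow> nat" where
  "eigen_multiplicity A lam =
     Max {length Zs | Zs. lin_indep_tensors Zs \<and> (\<forall>Z\<in>set Zs. eigen_tensor A lam Z)}"

text \<open>The eigenvalues in increasing order, each listed as often as its multiplicity.\<close>

definition eigenvalue_list :: "tensor \<Rightarrow> real list \<Rightarrow> bool" where
  "eigenvalue_list A evs \<longleftrightarrow>
     sorted evs \<and> (\<forall>lam. count (mset evs) lam = eigen_multiplicity A lam)"

text \<open>The eigenvalues of the given eigen-tensors are, as a multiset and hence in any order, the
  smallest \<open>length Zs\<close> entries of the list of eigenvalues.\<close>

definition smallest_eigen_tensors :: "tensor \<Rightarrow> tensor list \<Rightarrow> bool" where
  "smallest_eigen_tensors A Zs \<longleftrightarrow>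
     (\<exists>evs lams. eigenvalue_list A evs \<and> length lams = length Zs \<and>
        (\<forall>k<length Zs. eigen_tensor A (lams ! k) (Zs ! k)) \<and>
        mset lams = mset (take (length Zs) evs))"

section \<open>The OLPP problem\<close>

definition degree_mat :: "real mat \<Rightarrow> real mat" where
  "degree_mat W = mat_diag (dim_row W) (\<lambda>i. \<Sum>j<dim_col W. W $$ (i, j))"

definition laplacian :: "real mat \<Rightarrow> real mat" where
  "laplacian W = degree_mat W - W"

definition Phi_OLPP :: "real mat \<Rightarrow> tensor \<Rightarrow> real" where
  "Phi_OLPP W Y =
     1 / 2 * (\<Sum>i<dim_row W. \<Sum>j<dim_col W.
       W $$ (i, j) * (frob_norm (frontal_slice Y i - frontal_slice Y j))\<^sup>2)"

end

theory Submission
  imports Defs "HOL-Analysis.Function_Topology"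
begin

text \<open>The feasible tensors are exactly those with orthonormal frontal slices, and since the Laplacian
  represents the weighted sum of squared differences, the objective is the trace of the compression of
  the symmetric operator \<open>A\<close> to the span of the slices. Expanding the slices in an
  orthonormal eigenbasis of \<open>A\<close> turns the trace into a weighted sum of all eigenvalues, with weights
  in the unit interval (Bessel) of total \<open>d\<close> (Parseval); such a sum is at least the sum of the
  \<open>d\<close> smallest eigenvalues (Ky Fan).\<close>

section \<open>Real symmetric operators on a finite index set\<close>

text \<open>The Frobenius inner product and the contraction with \<open>A\<close> only see a finite
  set of multi-indices, so the linear algebra is done for functions on an abstract finite
  \<open>S\<close>, later \<open>tensor_idx Is\<close>, and no tensor is flattened into a vector.
  Dimension arguments become counting: \<open>card S\<close> is the dimension, and the projection
  lengths of coordinate vectors replace spans and bases. The delicate point is the word "smallest".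
  \<open>eigen_multiplicity\<close> is a maximum over arbitrary independent families, and a spectral
  \<open>P\<close> need not use the constructed eigenbasis at all. So the multiplicities have to be
  computed from that basis, which forces the eigenvalue list to be
  \<open>lam 0, ..., lam (N - 1)\<close>. After that only the sum of the eigenvalues of the slices
  of \<open>P\<close> matters, and it attains the Ky Fan bound.\<close>

text \<open>Vectors are functions on the index type of which only the values on \<open>S\<close> matter.\<close>

definition inner_on :: "'a set \<Rightarrow> ('a \<Rightarrow> real) \<Rightarrow> ('a \<Rightarrow> real) \<Rightarrow> real" where
  "inner_on S x y = (\<Sum>s\<in>S. x s * y s)"

definition apply_on :: "'a set \<Rightarrow> ('a \<Rightarrow> 'a \<Rightarrow> real) \<Rightarrow> ('a \<Rightarrow> real) \<Rightarrow> 'a \<Rightarrow> real" where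
  "apply_on S a x s = (\<Sum>t\<in>S. a s t * x t)"

definition orthonormal_on :: "'a set \<Rightarrow> 'i set \<Rightarrow> ('i \<Rightarrow> 'a \<Rightarrow> real) \<Rightarrow> bool" where
  "orthonormal_on S I u \<longleftrightarrow> (\<forall>i\<in>I. \<forall>j\<in>I. inner_on S (u i) (u j) = (if i = j then 1 else 0))"

lemma inner_on_cong:
  "(\<And>s. s \<in> S \<Longrightarrow> x s = x' s) \<Longrightarrow> (\<And>s. s \<in> S \<Longrightarrow> y s = y' s) \<Longrightarrow> inner_on S x y = inner_on S x' y'"
  unfolding inner_on_def by (rule sum.cong) auto

lemma inner_on_commute: "inner_on S x y = inner_on S y x"
  by (simp add: inner_on_def mult.commute)

lemma inner_on_linear:
  "inner_on S (\<lambda>s. x s + y s) z = inner_on S x z + inner_on S y z"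
  "inner_on S (\<lambda>s. x s - y s) z = inner_on S x z - inner_on S y z"
  "inner_on S (\<lambda>s. c * x s) z = c * inner_on S x z"
  "inner_on S z (\<lambda>s. x s + y s) = inner_on S z x + inner_on S z y"
  "inner_on S z (\<lambda>s. x s - y s) = inner_on S z x - inner_on S z y"
  "inner_on S z (\<lambda>s. c * x s) = c * inner_on S z x"
  by (simp_all add: inner_on_def algebra_simps sum.distrib sum_subtractf sum_distrib_left)

lemma inner_on_sum_right: "inner_on S z (\<lambda>s. \<Sum>i\<in>I. c i * u i s) = (\<Sum>i\<in>I. c i * inner_on S z (u i))"
  unfolding inner_on_def by (simp add: sum_distrib_left mult.left_commute) (rule sum.swap)

lemma inner_on_sum_left: "inner_on S (\<lambda>s. \<Sum>i\<in>I. c i * u i s) z = (\<Sum>i\<in>I. c i * inner_on S (u i) z)"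
  unfolding inner_on_commute[of S _ z] by (rule inner_on_sum_right)

lemma inner_on_self_nonneg: "inner_on S x x \<ge> 0"
  by (simp add: inner_on_def sum_nonneg)

lemma inner_on_self_eq_0_iff: "finite S \<Longrightarrow> inner_on S x x = 0 \<longleftrightarrow> (\<forall>s\<in>S. x s = 0)"
  by (simp add: inner_on_def sum_nonneg_eq_0_iff)

lemma apply_on_linear:
  "apply_on S a (\<lambda>s. x s + y s) = (\<lambda>s. apply_on S a x s + apply_on S a y s)"
  "apply_on S a (\<lambda>s. c * x s) = (\<lambda>s. c * apply_on S a x s)"
  by (auto simp: apply_on_def algebra_simps sum.distrib sum_distrib_left)

lemma inner_on_apply_on_symmetric:
  assumes "\<And>s t. s \<in> S \<Longrightarrow> t \<in> S \<Longrightarrow> a s t = a t s"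
  shows "inner_on S (apply_on S a x) y = inner_on S x (apply_on S a y)"
proof -
  have "inner_on S (apply_on S a x) y = (\<Sum>s\<in>S. \<Sum>t\<in>S. a s t * x t * y s)"
    by (simp add: inner_on_def apply_on_def sum_distrib_right)
  also have "\<dots> = (\<Sum>t\<in>S. \<Sum>s\<in>S. a s t * x t * y s)"
    by (rule sum.swap)
  also have "\<dots> = (\<Sum>t\<in>S. \<Sum>s\<in>S. x t * (a t s * y s))"
    by (intro sum.cong refl) (simp add: assms)
  finally show ?thesis
    by (simp add: inner_on_def apply_on_def sum_distrib_left)
qed

section \<open>Orthogonal projection, Bessel and Parseval\<close>

text \<open>\<open>r x\<close> is what remains of \<open>x\<close> after orthogonal projection to
  the span of \<open>u\<close>, and the second claim is Pythagoras. Nonnegativity of the squared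
  length gives Bessel; where it is positive, \<open>r x\<close> supplies a new orthogonal
  direction.\<close>

lemma orthonormal_on_residual:
  assumes "finite I" "orthonormal_on S I u"
  defines "r \<equiv> \<lambda>x s. x s - (\<Sum>i\<in>I. inner_on S x (u i) * u i s)"
  shows "i \<in> I \<Longrightarrow> inner_on S (r x) (u i) = 0"
    and "inner_on S (r x) (r x) = inner_on S x x - (\<Sum>i\<in>I. (inner_on S x (u i))\<^sup>2)"
proof -
  show orth: "inner_on S (r x) (u i) = 0" if "i \<in> I" for i
  proof -
    have "(\<Sum>j\<in>I. inner_on S x (u j) * inner_on S (u j) (u i))
        = (\<Sum>j\<in>I. if j = i then inner_on S x (u j) else 0)"
      using assms(2) that by (intro sum.cong refl) (auto simp: orthonormal_on_def)
    then show ?thesis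
      using that assms(1) by (simp add: r_def inner_on_linear inner_on_sum_left)
  qed
  have "inner_on S (r x) (r x) = inner_on S (r x) x - (\<Sum>i\<in>I. inner_on S x (u i) * inner_on S (r x) (u i))"
    by (subst (2) r_def) (simp add: inner_on_linear inner_on_sum_right)
  also have "\<dots> = inner_on S (r x) x"
    by (simp add: orth)
  finally show "inner_on S (r x) (r x) = inner_on S x x - (\<Sum>i\<in>I. (inner_on S x (u i))\<^sup>2)"
    by (simp add: r_def inner_on_linear inner_on_sum_left inner_on_commute[of S "u _" x] power2_eq_square)
qed

lemma bessel:
  assumes "finite I" "orthonormal_on S I u"
  shows "(\<Sum>i\<in>I. (inner_on S x (u i))\<^sup>2) \<le> inner_on S x x"
proof -
  have "0 \<le> inner_on S x x - (\<Sum>i\<in>I. (inner_on S x (u i))\<^sup>2)"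
    unfolding orthonormal_on_residual(2)[OF assms, symmetric] by (rule inner_on_self_nonneg)
  then show ?thesis by simp
qed

lemma inner_on_unit:
  assumes "finite S" "s \<in> S"
  shows "inner_on S (\<lambda>t. if t = s then 1 else 0) y = y s"
proof -
  have "inner_on S (\<lambda>t. if t = s then 1 else 0) y = (\<Sum>t\<in>S. if t = s then y t else 0)"
    unfolding inner_on_def by (rule sum.cong) auto
  then show ?thesis using assms by simp
qed

text \<open>The inner sum is the squared length of the projected unit vector at \<open>s\<close>, a
  diagonal entry of the projection to the span of \<open>u\<close>; the total is the trace of that
  projection, hence its rank.\<close>

lemma sum_squares_orthonormal:
  assumes "orthonormal_on S I u"
  shows "(\<Sum>s\<in>S. \<Sum>i\<in>I. (u i s)\<^sup>2) = real (card I)"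
proof -
  have "(\<Sum>s\<in>S. \<Sum>i\<in>I. (u i s)\<^sup>2) = (\<Sum>i\<in>I. inner_on S (u i) (u i))"
    by (subst sum.swap) (simp add: inner_on_def power2_eq_square)
  also have "\<dots> = real (card I)"
    using assms by (simp add: orthonormal_on_def)
  finally show ?thesis .
qed

text \<open>The squared lengths of the projections of the unit vectors to the span of \<open>u\<close> sum to
  \<open>card I\<close>, so some unit vector does not lie in that span.\<close>

lemma exists_unit_orthogonal:
  assumes "finite S" "finite I" "orthonormal_on S I u" "card I < card S"
  shows "\<exists>x. inner_on S x x = 1 \<and> (\<forall>i\<in>I. inner_on S x (u i) = 0)"
proof -
  have "\<exists>s\<in>S. (\<Sum>i\<in>I. (u i s)\<^sup>2) < 1"
  proof (rule ccontr)
    assume "\<not> ?thesis"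
    then have "(\<Sum>s\<in>S. 1) \<le> (\<Sum>s\<in>S. \<Sum>i\<in>I. (u i s)\<^sup>2)"
      by (intro sum_mono) (auto simp: not_less)
    then show False
      using assms sum_squares_orthonormal[OF assms(3)] by simp
  qed
  then obtain s where s: "s \<in> S" "(\<Sum>i\<in>I. (u i s)\<^sup>2) < 1" by blast
  define e :: "'a \<Rightarrow> real" where "e = (\<lambda>t. if t = s then 1 else 0)"
  define r where "r = (\<lambda>t. e t - (\<Sum>i\<in>I. inner_on S e (u i) * u i t))"
  have e: "inner_on S e y = y s" for y
    unfolding e_def by (rule inner_on_unit[OF assms(1) s(1)])
  have "inner_on S r r = 1 - (\<Sum>i\<in>I. (u i s)\<^sup>2)"
    unfolding r_def orthonormal_on_residual(2)[OF assms(2,3)] by (simp add: e) (simp add: e_def)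
  then have pos: "inner_on S r r > 0" using s by simp
  define x where "x = (\<lambda>t. inverse (sqrt (inner_on S r r)) * r t)"
  have "inner_on S x x = 1"
    unfolding x_def inner_on_linear using pos by (simp add: field_simps)
  moreover have "inner_on S x (u i) = 0" if "i \<in> I" for i
    using orthonormal_on_residual(1)[OF assms(2,3) that, of e] by (simp add: x_def r_def inner_on_linear)
  ultimately show ?thesis by blast
qed

lemma orthonormal_on_insert:
  assumes "orthonormal_on S I u" "i \<notin> I" "inner_on S x x = 1" "\<And>j. j \<in> I \<Longrightarrow> inner_on S x (u j) = 0"
  shows "orthonormal_on S (insert i I) (u(i := x))"
  using assms by (auto simp: orthonormal_on_def inner_on_commute[of S "u _" x])

text \<open>By Bessel every unit vector has a projection of squared length at most 1. These lengths
  sum to \<open>card I = card S\<close>, so each of them is exactly 1 and every unit vector agrees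
  on \<open>S\<close> with its projection.\<close>

lemma parseval:
  assumes "finite S" "finite I" "orthonormal_on S I u" "card I = card S"
  shows "s \<in> S \<Longrightarrow> x s = (\<Sum>i\<in>I. inner_on S x (u i) * u i s)"
    and "inner_on S x x = (\<Sum>i\<in>I. (inner_on S x (u i))\<^sup>2)"
proof -
  have le: "(\<Sum>i\<in>I. (u i s)\<^sup>2) \<le> 1" if "s \<in> S" for s
    using bessel[OF assms(2,3), of "\<lambda>t. if t = s then 1 else 0"] assms(1) that
    by (simp add: inner_on_unit)
  have one: "(\<Sum>i\<in>I. (u i s)\<^sup>2) = 1" if "s \<in> S" for s
  proof (rule ccontr)
    assume "(\<Sum>i\<in>I. (u i s)\<^sup>2) \<noteq> 1"
    with le[OF that] have "(\<Sum>i\<in>I. (u i s)\<^sup>2) < 1" by simp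
    then have "(\<Sum>s\<in>S. \<Sum>i\<in>I. (u i s)\<^sup>2) < (\<Sum>s\<in>S. 1)"
      using assms(1) le that by (intro sum_strict_mono_ex1) auto
    then show False using sum_squares_orthonormal[OF assms(3)] assms(4) by simp
  qed
  have expand: "x s = (\<Sum>i\<in>I. inner_on S x (u i) * u i s)" if s: "s \<in> S" for s
  proof -
    define e :: "'a \<Rightarrow> real" where "e = (\<lambda>t. if t = s then 1 else 0)"
    define r where "r = (\<lambda>t. e t - (\<Sum>i\<in>I. inner_on S e (u i) * u i t))"
    have e: "inner_on S e y = y s" for y
      unfolding e_def by (rule inner_on_unit[OF assms(1) s])
    have "inner_on S r r = 0"
      unfolding r_def orthonormal_on_residual(2)[OF assms(2,3)] using one[OF s]
      by (simp add: e) (simp add: e_def)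
    then have "\<forall>t\<in>S. r t = 0" using assms(1) inner_on_self_eq_0_iff by blast
    \<comment> \<open>Pairing \<open>x\<close> with \<open>r\<close>, which vanishes on
      \<open>S\<close>, yields \<open>x s\<close> from the part \<open>e\<close> and the expansion
      at \<open>s\<close> from the projection part.\<close>
    then have "0 = inner_on S x r" by (simp add: inner_on_def)
    also have "\<dots> = x s - (\<Sum>i\<in>I. inner_on S x (u i) * u i s)"
      by (simp add: r_def inner_on_linear inner_on_sum_right e inner_on_commute[of S x e]) (simp add: mult.commute)
    finally show ?thesis by simp
  qed
  then show "s \<in> S \<Longrightarrow> x s = (\<Sum>i\<in>I. inner_on S x (u i) * u i s)" .
  have "inner_on S x x = inner_on S x (\<lambda>s. \<Sum>i\<in>I. inner_on S x (u i) * u i s)"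
    by (rule inner_on_cong) (auto intro: expand)
  then show "inner_on S x x = (\<Sum>i\<in>I. (inner_on S x (u i))\<^sup>2)"
    by (simp add: inner_on_sum_right power2_eq_square)
qed

section \<open>Variational construction of an eigenbasis\<close>

text \<open>Near \<open>t = 0\<close> the linear term dominates, so a nonzero \<open>b\<close> would
  give a negative value. This plays the part of the vanishing derivative at a minimum.\<close>

lemma linear_quadratic_nonneg_imp_eq_0:
  fixes b c :: real
  assumes "\<And>t. 2 * t * b + t\<^sup>2 * c \<ge> 0"
  shows "b = 0"
proof (rule ccontr)
  assume "b \<noteq> 0"
  \<comment> \<open>\<open>k\<close> is a positive upper bound of \<open>c\<close>, and
    \<open>- b / k\<close> is the minimizer of \<open>2 * t * b + t\<^sup>2 * k\<close>, with value
    \<open>- (b * b) / k\<close>.\<close>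
  define k where "k = \<bar>c\<bar> + 1"
  define t where "t = - b / k"
  have k: "k > 0" "c \<le> k" by (auto simp: k_def)
  then have tk: "t * k = - b" by (simp add: t_def)
  have "2 * t * b + t\<^sup>2 * c \<le> 2 * t * b + t\<^sup>2 * k"
    using k(2) by (intro add_left_mono mult_left_mono) auto
  also have "t\<^sup>2 * k = - (t * b)"
    using tk by (simp add: power2_eq_square mult.assoc)
  also have "2 * t * b + - (t * b) = - (b * b) / k"
    by (simp add: t_def)
  also have "\<dots> < 0"
    using \<open>b \<noteq> 0\<close> k(1) by (metis divide_neg_pos neg_less_0_iff_less not_real_square_gt_zero)
  finally have "2 * t * b + t\<^sup>2 * c < 0" .
  with assms[of t] show False by (meson not_less)
qed

lemma rayleigh_minimum:
  assumes "finite S" "finite I" "orthonormal_on S I u" "card I < card S"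
  shows "\<exists>x. inner_on S x x = 1 \<and> (\<forall>i\<in>I. inner_on S x (u i) = 0) \<and>
    (\<forall>y. inner_on S y y = 1 \<and> (\<forall>i\<in>I. inner_on S y (u i) = 0) \<longrightarrow>
      inner_on S x (apply_on S a x) \<le> inner_on S y (apply_on S a y))"
proof -
  \<comment> \<open>\<open>inner_on\<close> does not constrain values outside \<open>S\<close>, so
    \<open>C\<close> alone is not compact in general. Pinning those values to 0 makes
    \<open>B\<close> a product of compact sets, compact by Tychonoff. By \<open>restrict\<close>
    below, this truncation does not change the quadratic form, so a minimum over
    \<open>B \<inter> C\<close> is a minimum over all admissible vectors.\<close>
  define B where "B = PiE UNIV (\<lambda>s. if s \<in> S then {-1..1} else {0::real})"
  define C where "C = {x. inner_on S x x = 1} \<inter> (\<Inter>i\<in>I. {x. inner_on S x (u i) = 0})"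
  have cont: "continuous_on UNIV (\<lambda>x :: 'a \<Rightarrow> real. x s)" for s by simp
  have cont_in: "continuous_on UNIV (\<lambda>x :: 'a \<Rightarrow> real. inner_on S x x)"
    "\<And>y. continuous_on UNIV (\<lambda>x :: 'a \<Rightarrow> real. inner_on S x y)"
    "continuous_on UNIV (\<lambda>x :: 'a \<Rightarrow> real. inner_on S x (apply_on S a x))"
    unfolding inner_on_def apply_on_def by (intro continuous_intros cont)+
  have "compactin (product_topology (\<lambda>_. euclidean) UNIV) B"
    unfolding B_def compactin_PiE by auto
  then have "compact B" by (simp add: euclidean_product_topology)
  moreover have "closed C"
    unfolding C_def by (intro closed_Int closed_INT ballI closed_Collect_eq cont_in continuous_on_const)
  ultimately have "compact (B \<inter> C)" by (rule compact_Int_closed)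
  have restrict: "\<exists>x'\<in>B \<inter> C. inner_on S x' (apply_on S a x') = inner_on S x (apply_on S a x)"
    if x: "inner_on S x x = 1" "\<forall>i\<in>I. inner_on S x (u i) = 0" for x
  proof
    let ?x = "\<lambda>s. if s \<in> S then x s else 0"
    have "\<bar>x s\<bar> \<le> 1" if "s \<in> S" for s
    proof -
      have "x s * x s \<le> inner_on S x x"
        unfolding inner_on_def by (rule member_le_sum[OF that]) (auto simp: assms(1))
      then show ?thesis using x(1) by (simp add: abs_square_le_1 flip: power2_eq_square)
    qed
    then have "?x \<in> B" by (auto simp: B_def abs_le_iff minus_le_iff)
    moreover have "inner_on S ?x ?x = inner_on S x x" "inner_on S ?x y = inner_on S x y" for y
      by (rule inner_on_cong; simp)+
    ultimately show "?x \<in> B \<inter> C" using x by (simp add: C_def)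
    have "apply_on S a ?x = apply_on S a x"
      unfolding apply_on_def by (intro ext sum.cong) auto
    then show "inner_on S ?x (apply_on S a ?x) = inner_on S x (apply_on S a x)"
      by (simp cong: inner_on_cong)
  qed
  obtain x0 where "inner_on S x0 x0 = 1" "\<forall>i\<in>I. inner_on S x0 (u i) = 0"
    using exists_unit_orthogonal[OF assms] by blast
  from restrict[OF this] have "B \<inter> C \<noteq> {}" by blast
  from continuous_attains_inf[OF \<open>compact (B \<inter> C)\<close> this continuous_on_subset[OF cont_in(3)]]
  obtain x where x: "x \<in> B \<inter> C"
    and min: "\<And>y. y \<in> B \<inter> C \<Longrightarrow> inner_on S x (apply_on S a x) \<le> inner_on S y (apply_on S a y)"
    by auto
  show ?thesis
  proof (intro exI[of _ x] conjI allI impI)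
    show "inner_on S x x = 1" "\<forall>i\<in>I. inner_on S x (u i) = 0"
      using x by (auto simp: C_def)
    fix y assume "inner_on S y y = 1 \<and> (\<forall>i\<in>I. inner_on S y (u i) = 0)"
    then show "inner_on S x (apply_on S a x) \<le> inner_on S y (apply_on S a y)"
      using restrict[of y] min by metis
  qed
qed

text \<open>The defect \<open>v\<close> of the eigenvalue equation is orthogonal to every
  \<open>u i\<close>: symmetry moves \<open>a\<close> to the eigenvector \<open>u i\<close>, to
  which \<open>x\<close> is orthogonal. So stationarity at \<open>x\<close> may be tested in the
  direction \<open>v\<close> itself, and this says that \<open>v\<close> has length 0.\<close>

lemma rayleigh_minimum_eigenvector:
  assumes fin: "finite S" and sym: "\<And>s t. s \<in> S \<Longrightarrow> t \<in> S \<Longrightarrow> a s t = a t s"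
    and eig: "\<And>i s. i \<in> I \<Longrightarrow> s \<in> S \<Longrightarrow> apply_on S a (u i) s = lam i * u i s"
    and x: "inner_on S x x = 1" "\<And>i. i \<in> I \<Longrightarrow> inner_on S x (u i) = 0"
    and min: "\<And>y. inner_on S y y = 1 \<Longrightarrow> (\<And>i. i \<in> I \<Longrightarrow> inner_on S y (u i) = 0) \<Longrightarrow>
      m \<le> inner_on S y (apply_on S a y)"
    and m: "m = inner_on S x (apply_on S a x)"
    and s: "s \<in> S"
  shows "apply_on S a x s = m * x s"
proof -
  let ?q = "\<lambda>y. inner_on S y (apply_on S a y)"
  have symm: "inner_on S (apply_on S a x) y = inner_on S x (apply_on S a y)" for x y
    by (rule inner_on_apply_on_symmetric) (rule sym)
  \<comment> \<open>Homogeneous form of the minimum property, so that \<open>x + t * v\<close> can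
    be inserted without being normalized.\<close>
  have bound: "m * inner_on S y y \<le> ?q y" if "\<And>i. i \<in> I \<Longrightarrow> inner_on S y (u i) = 0" for y
  proof (cases "inner_on S y y = 0")
    case True
    then have "\<forall>s\<in>S. y s = 0" using fin inner_on_self_eq_0_iff by blast
    then show ?thesis by (simp add: inner_on_def)
  next
    case False
    then have pos: "inner_on S y y > 0" using inner_on_self_nonneg[of S y] by simp
    define c where "c = inverse (sqrt (inner_on S y y))"
    have c: "c * c = inverse (inner_on S y y)" using pos by (simp add: c_def field_simps)
    have "m \<le> ?q (\<lambda>s. c * y s)"
    proof (rule min)
      show "inner_on S (\<lambda>s. c * y s) (\<lambda>s. c * y s) = 1"
        using pos c by (simp add: inner_on_linear flip: mult.assoc)
    qed (simp add: inner_on_linear that)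
    also have "\<dots> = inverse (inner_on S y y) * ?q y"
      by (simp add: inner_on_linear apply_on_linear flip: mult.assoc c)
    finally show ?thesis using pos by (simp add: field_simps)
  qed
  define v where "v = (\<lambda>s. apply_on S a x s - m * x s)"
  have v_orth: "inner_on S v (u i) = 0" if "i \<in> I" for i
  proof -
    have "inner_on S x (apply_on S a (u i)) = inner_on S x (\<lambda>s. lam i * u i s)"
      by (rule inner_on_cong) (auto simp: eig that)
    then show ?thesis using x(2)[OF that] by (simp add: v_def inner_on_linear symm)
  qed
  \<comment> \<open>First-order condition for the minimum at \<open>x\<close> in the direction \<open>v\<close>, which is admissible by \<open>v_orth\<close>\<close>
  have "inner_on S v (apply_on S a x) - m * inner_on S v x = 0"
  proof (rule linear_quadratic_nonneg_imp_eq_0)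
    fix t :: real
    have "m * inner_on S (\<lambda>s. x s + t * v s) (\<lambda>s. x s + t * v s) \<le> ?q (\<lambda>s. x s + t * v s)"
      by (rule bound) (simp add: inner_on_linear x(2) v_orth)
    moreover have "inner_on S x (apply_on S a v) = inner_on S v (apply_on S a x)"
      using symm[of x v] inner_on_commute by metis
    ultimately show "0 \<le> 2 * t * (inner_on S v (apply_on S a x) - m * inner_on S v x)
        + t\<^sup>2 * (?q v - m * inner_on S v v)"
      using x(1) by (simp add: inner_on_linear apply_on_linear m[symmetric] inner_on_commute[of S x v]
          power2_eq_square algebra_simps)
  qed
  then have "inner_on S v v = 0"
    by (subst (2) v_def) (simp add: inner_on_linear)
  then have "v s = 0" using fin s inner_on_self_eq_0_iff by blast
  then show ?thesis by (simp add: v_def)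
qed

text \<open>The minimality clause makes the eigenvalues come out in increasing order.\<close>

lemma greedy_orthonormal_eigenvectors:
  assumes fin: "finite S" and sym: "\<forall>s\<in>S. \<forall>t\<in>S. a s t = a t s"
  shows "k \<le> card S \<Longrightarrow> \<exists>u lam. orthonormal_on S {..<k} u \<and>
    (\<forall>i<k. \<forall>s\<in>S. apply_on S a (u i) s = lam i * u i s) \<and>
    (\<forall>i<k. \<forall>y. inner_on S y y = 1 \<and> (\<forall>j<i. inner_on S y (u j) = 0) \<longrightarrow>
      lam i \<le> inner_on S y (apply_on S a y))"
proof (induction k)
  case 0
  show ?case by (simp add: orthonormal_on_def)
next
  case (Suc k)
  from Suc.IH[OF Suc_leD[OF Suc.prems]]
  obtain u lam where u: "orthonormal_on S {..<k} u"
    and eig': "\<forall>i<k. \<forall>s\<in>S. apply_on S a (u i) s = lam i * u i s"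
    and min': "\<forall>i<k. \<forall>y. inner_on S y y = 1 \<and> (\<forall>j<i. inner_on S y (u j) = 0) \<longrightarrow>
      lam i \<le> inner_on S y (apply_on S a y)"
    by (elim exE conjE) (rule that)
  have eig: "apply_on S a (u i) s = lam i * u i s" if "i < k" "s \<in> S" for i s
    using eig' that by blast
  have min: "lam i \<le> inner_on S y (apply_on S a y)"
    if "i < k" "inner_on S y y = 1" "\<And>j. j < i \<Longrightarrow> inner_on S y (u j) = 0" for i y
    using min' that by blast
  obtain x where x: "inner_on S x x = 1" "\<And>i. i < k \<Longrightarrow> inner_on S x (u i) = 0"
    and xmin: "\<And>y. inner_on S y y = 1 \<Longrightarrow> (\<And>i. i < k \<Longrightarrow> inner_on S y (u i) = 0) \<Longrightarrow>
      inner_on S x (apply_on S a x) \<le> inner_on S y (apply_on S a y)"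
    using rayleigh_minimum[OF fin _ u, of a] Suc.prems by auto
  define m where "m = inner_on S x (apply_on S a x)"
  have xeig: "apply_on S a x s = m * x s" if "s \<in> S" for s
    using rayleigh_minimum_eigenvector[where I = "{..<k}" and u = u and lam = lam and m = m and x = x]
      fin sym eig x xmin that m_def by simp
  show ?case
  proof (intro exI[of _ "u(k := x)"] exI[of _ "lam(k := m)"] conjI allI impI ballI)
    show "orthonormal_on S {..<Suc k} (u(k := x))"
      unfolding lessThan_Suc by (rule orthonormal_on_insert) (use u x in auto)
  next
    fix i s assume "i < Suc k" "s \<in> S"
    then show "apply_on S a ((u(k := x)) i) s = (lam(k := m)) i * (u(k := x)) i s"
      using eig xeig by (auto simp: less_Suc_eq)
  next
    fix i y assume "i < Suc k" "inner_on S y y = 1 \<and> (\<forall>j<i. inner_on S y ((u(k := x)) j) = 0)"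
    then show "(lam(k := m)) i \<le> inner_on S y (apply_on S a y)"
      using min[of i y] xmin[of y] by (cases "i = k") (auto simp: m_def)
  qed
qed

text \<open>The order of the eigenvalues comes from the minimum property: for
  \<open>i \<le> j\<close> the vector \<open>u j\<close> is itself a competitor for
  \<open>lam i\<close>, and its Rayleigh quotient is \<open>lam j\<close>.\<close>

theorem spectral_theorem_sorted:
  assumes fin: "finite S" and sym: "\<forall>s\<in>S. \<forall>t\<in>S. a s t = a t s"
  obtains u lam where "orthonormal_on S {..<card S} u"
    "\<And>i s. i < card S \<Longrightarrow> s \<in> S \<Longrightarrow> apply_on S a (u i) s = lam i * u i s"
    "\<And>i j. i \<le> j \<Longrightarrow> j < card S \<Longrightarrow> lam i \<le> lam j"
proof -
  from greedy_orthonormal_eigenvectors[of S a, OF fin sym order_refl]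
  obtain u lam where u: "orthonormal_on S {..<card S} u"
    and eig': "\<forall>i<card S. \<forall>s\<in>S. apply_on S a (u i) s = lam i * u i s"
    and min': "\<forall>i<card S. \<forall>y. inner_on S y y = 1 \<and> (\<forall>j<i. inner_on S y (u j) = 0) \<longrightarrow>
      lam i \<le> inner_on S y (apply_on S a y)"
    by (elim exE conjE) (rule that)
  have eig: "apply_on S a (u i) s = lam i * u i s" if "i < card S" "s \<in> S" for i s
    using eig' that by blast
  have min: "lam i \<le> inner_on S y (apply_on S a y)"
    if "i < card S" "inner_on S y y = 1" "\<And>j. j < i \<Longrightarrow> inner_on S y (u j) = 0" for i y
    using min' that by blast
  have "lam i \<le> lam j" if "i \<le> j" "j < card S" for i j
  proof -
    have "lam i \<le> inner_on S (u j) (apply_on S a (u j))"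
      using u that by (intro min) (auto simp: orthonormal_on_def)
    also have "\<dots> = inner_on S (u j) (\<lambda>s. lam j * u j s)"
      by (rule inner_on_cong) (auto simp: eig that)
    also have "\<dots> = lam j"
      using u that by (simp add: inner_on_linear orthonormal_on_def)
    finally show ?thesis .
  qed
  then show thesis using that u eig by blast
qed

section \<open>Ky Fan's inequality\<close>

text \<open>The weights \<open>w\<close> and the indicator of \<open>{..<d}\<close> have the same
  total. As \<open>w\<close> stays in the unit interval, passing to the indicator only moves weight
  from indices at or above \<open>d\<close> to indices below \<open>d\<close>, where the eigenvalues
  are no larger.\<close>

lemma ky_fan_minimum:
  fixes lam :: "nat \<Rightarrow> real"
  assumes fin: "finite S"
    and u: "orthonormal_on S {..<card S} u"
    and eig: "\<And>i s. i < card S \<Longrightarrow> s \<in> S \<Longrightarrow> apply_on S a (u i) s = lam i * u i s"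
    and mono: "\<And>i j. i \<le> j \<Longrightarrow> j < card S \<Longrightarrow> lam i \<le> lam j"
    and K: "finite K" "card K \<le> card S" and q: "orthonormal_on S K q"
  shows "(\<Sum>i<card K. lam i) \<le> (\<Sum>k\<in>K. inner_on S (q k) (apply_on S a (q k)))"
proof (cases "card K = 0")
  case True
  then show ?thesis using K by simp
next
  case False
  define N where "N = card S"
  define d where "d = card K"
  define w where "w i = (\<Sum>k\<in>K. (inner_on S (q k) (u i))\<^sup>2)" for i
  have qform: "inner_on S x (apply_on S a x) = (\<Sum>i<N. lam i * (inner_on S x (u i))\<^sup>2)" for x
  proof -
    have ax: "apply_on S a x s = (\<Sum>i<N. (inner_on S x (u i) * lam i) * u i s)" if "s \<in> S" for s
    proof -
      have "apply_on S a x s = (\<Sum>t\<in>S. a s t * (\<Sum>i<N. inner_on S x (u i) * u i t))"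
        unfolding apply_on_def N_def
        using parseval(1)[OF fin _ u, of _ x] by (intro sum.cong refl) auto
      also have "\<dots> = (\<Sum>i<N. inner_on S x (u i) * apply_on S a (u i) s)"
        unfolding apply_on_def sum_distrib_left by (subst sum.swap) (simp add: mult.left_commute)
      finally show ?thesis using eig that by (simp add: N_def mult.assoc)
    qed
    have "inner_on S x (apply_on S a x) = inner_on S x (\<lambda>s. \<Sum>i<N. (inner_on S x (u i) * lam i) * u i s)"
      by (rule inner_on_cong) (auto simp: ax)
    then show ?thesis
      unfolding inner_on_sum_right by (simp add: power2_eq_square mult_ac)
  qed
  \<comment> \<open>Bessel expands \<open>u i\<close> along the possibly incomplete family
    \<open>q\<close>; in \<open>w_sum\<close> the roles are reversed, and Parseval expands
    \<open>q k\<close> in the complete family \<open>u\<close>.\<close>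
  have w_le: "w i \<le> 1" if "i < N" for i
    using bessel[OF K(1) q, of "u i"] u that
    by (simp add: w_def orthonormal_on_def N_def inner_on_commute[of S "u i" "q _"])
  have w_ge: "0 \<le> w i" for i by (simp add: w_def sum_nonneg)
  have w_sum: "(\<Sum>i<N. w i) = real d"
  proof -
    have "(\<Sum>i<N. w i) = (\<Sum>k\<in>K. \<Sum>i<N. (inner_on S (q k) (u i))\<^sup>2)"
      unfolding w_def by (rule sum.swap)
    also have "\<dots> = (\<Sum>k\<in>K. inner_on S (q k) (q k))"
      unfolding N_def by (rule sum.cong[OF refl], rule parseval(2)[OF fin _ u, symmetric]) auto
    finally have "(\<Sum>i<N. w i) = (\<Sum>k\<in>K. inner_on S (q k) (q k))" .
    then show ?thesis using q by (simp add: orthonormal_on_def d_def)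
  qed
  have dN: "d \<le> N" "0 < d" using K False by (auto simp: d_def N_def)
  \<comment> \<open>The largest of the \<open>d\<close> smallest eigenvalues serves as threshold.
    Subtracting it from every \<open>lam i\<close> changes nothing in the comparison, because both
    weight systems have total \<open>d\<close>.\<close>
  let ?c = "lam (d - 1)"
  \<comment> \<open>Both factors change sign at \<open>i = d\<close>.\<close>
  have "0 \<le> (\<Sum>i<N. (lam i - ?c) * (w i - of_bool (i < d)))"
  proof (rule sum_nonneg)
    fix i assume i: "i \<in> {..<N}"
    show "0 \<le> (lam i - ?c) * (w i - of_bool (i < d))"
    proof (cases "i < d")
      case True
      then have "lam i \<le> ?c" using dN by (intro mono) (auto simp: N_def)
      then show ?thesis using True w_le i by (simp add: mult_nonpos_nonpos)
    next
      case False
      then have "?c \<le> lam i" using dN i by (intro mono) (auto simp: N_def)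
      then show ?thesis using False w_ge by simp
    qed
  qed
  also have "\<dots> = (\<Sum>i<N. lam i * w i) - (\<Sum>i<N. lam i * of_bool (i < d))
      - ?c * ((\<Sum>i<N. w i) - (\<Sum>i<N. of_bool (i < d)))"
    by (simp add: algebra_simps sum.distrib sum_subtractf sum_distrib_left sum_distrib_right)
  also have "(\<Sum>i<N. of_bool (i < d)) = (\<Sum>i<d. 1 :: real)"
    using dN by (intro sum.mono_neutral_cong_right) auto
  also have "(\<Sum>i<N. lam i * of_bool (i < d)) = (\<Sum>i<d. lam i)"
    using dN by (intro sum.mono_neutral_cong_right) auto
  also have "(\<Sum>i<N. lam i * w i) = (\<Sum>k\<in>K. inner_on S (q k) (apply_on S a (q k)))"
    unfolding qform w_def sum_distrib_left by (rule sum.swap)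
  finally show ?thesis by (simp add: w_sum d_def)
qed

text \<open>Gaussian elimination, one equation and one unknown at a time. It is what bounds the size
  of an independent family of eigen-tensors.\<close>

lemma homogeneous_system_nontrivial_solution:
  fixes c :: "'k \<Rightarrow> 'j \<Rightarrow> real"
  assumes "finite K" "finite J" "card K < card J"
  shows "\<exists>x. (\<exists>j\<in>J. x j \<noteq> 0) \<and> (\<forall>k\<in>K. (\<Sum>j\<in>J. c k j * x j) = 0)"
  using assms
proof (induction K arbitrary: J c rule: finite_induct)
  case empty
  then obtain j where "j \<in> J" by fastforce
  then show ?case by (intro exI[of _ "\<lambda>_. 1"]) auto
next
  case (insert k0 K)
  show ?case
  proof (cases "\<forall>j\<in>J. c k0 j = 0")
    case True
    then show ?thesis using insert.IH[of J c] insert by auto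
  next
    case False
    then obtain j0 where j0: "j0 \<in> J" "c k0 j0 \<noteq> 0" by blast
    let ?J = "J - {j0}"
    have "card K < card ?J" using insert j0 by (simp add: card_Diff_singleton)
    \<comment> \<open>The new coefficients arise by subtracting the multiple of equation
      \<open>k0\<close> that cancels the unknown \<open>j0\<close>. The value \<open>y j0\<close>
      below is then found by solving equation \<open>k0\<close>.\<close>
    from insert.IH[OF _ this, of "\<lambda>k j. c k j - c k j0 * c k0 j / c k0 j0"] insert.prems
    obtain x j1 where j1: "j1 \<in> ?J" "x j1 \<noteq> 0"
      and x: "\<And>k. k \<in> K \<Longrightarrow> (\<Sum>j\<in>?J. (c k j - c k j0 * c k0 j / c k0 j0) * x j) = 0"
      by auto
    define y where "y = x(j0 := - (\<Sum>j\<in>?J. c k0 j * x j) / c k0 j0)"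
    have split: "(\<Sum>j\<in>J. c k j * y j) = c k j0 * y j0 + (\<Sum>j\<in>?J. c k j * x j)" for k
      using j0 insert.prems by (simp add: sum.remove y_def)
    have "(\<Sum>j\<in>J. c k j * y j) = 0" if "k \<in> insert k0 K" for k
    proof (cases "k = k0")
      case True
      then show ?thesis unfolding split using j0 by (simp add: y_def)
    next
      case False
      then have "0 = (\<Sum>j\<in>?J. (c k j - c k j0 * c k0 j / c k0 j0) * x j)" using x that by simp
      also have "\<dots> = (\<Sum>j\<in>?J. c k j * x j) - c k j0 / c k0 j0 * (\<Sum>j\<in>?J. c k0 j * x j)"
        by (simp add: algebra_simps sum_subtractf sum_distrib_left)
      finally show ?thesis unfolding split by (simp add: y_def)
    qed
    moreover have "y j1 \<noteq> 0" using j1 by (simp add: y_def)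
    ultimately show ?thesis using j1 by blast
  qed
qed

section \<open>Tensors as functions of multi-indices\<close>

lemma tensor_idx_Nil: "tensor_idx [] = {[]}"
  by (auto simp: tensor_idx_def)

lemma tensor_idx_Cons: "tensor_idx (n # ds) = (\<lambda>(i, is). i # is) ` ({..<n} \<times> tensor_idx ds)"
  by (auto simp: tensor_idx_def list_all2_Cons2)

lemma finite_tensor_idx: "finite (tensor_idx ds)"
  by (induction ds) (auto simp: tensor_idx_Nil tensor_idx_Cons)

lemma card_tensor_idx: "card (tensor_idx ds) = prod_list ds"
proof (induction ds)
  case (Cons n ds)
  have "inj_on (\<lambda>(i, is). i # is) ({..<n} \<times> tensor_idx ds)"
    by (auto simp: inj_on_def)
  then show ?case using Cons by (simp add: tensor_idx_Cons card_image card_cartesian_product)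
qed (simp add: tensor_idx_Nil)

lemma length_tensor_idx: "is \<in> tensor_idx ds \<Longrightarrow> length is = length ds"
  by (auto simp: tensor_idx_def dest: list_all2_lengthD)

lemma Cons_in_tensor_idx: "i # is \<in> tensor_idx (n # ds) \<longleftrightarrow> i < n \<and> is \<in> tensor_idx ds"
  by (simp add: tensor_idx_def)

lemma append_in_tensor_idx:
  "length is = length ds \<Longrightarrow> is @ js \<in> tensor_idx (ds @ es) \<longleftrightarrow> is \<in> tensor_idx ds \<and> js \<in> tensor_idx es"
  by (simp add: tensor_idx_def list_all2_append)

lemma snoc_in_tensor_idx: "is \<in> tensor_idx ds \<Longrightarrow> is @ [i] \<in> tensor_idx (ds @ [n]) \<longleftrightarrow> i < n"
  by (simp add: append_in_tensor_idx length_tensor_idx Cons_in_tensor_idx tensor_idx_Nil)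

lemma tensor_idx_pair: "is \<in> tensor_idx [m, n] \<longleftrightarrow> (\<exists>i<m. \<exists>j<n. is = [i, j])"
  by (auto simp: tensor_idx_Cons tensor_idx_Nil image_iff)

lemma sum_tensor_idx_singleton: "(\<Sum>is\<in>tensor_idx [n]. f is) = (\<Sum>i<n. f [i])"
proof -
  have "tensor_idx [n] = (\<lambda>i. [i]) ` {..<n}"
    by (auto simp: tensor_idx_Cons tensor_idx_Nil)
  then show ?thesis by (simp add: sum.reindex inj_on_def)
qed

lemma tensor_inner_conv_inner_on: "tensor_inner A B = inner_on (tensor_idx (shape A)) (entry A) (entry B)"
  by (simp add: tensor_inner_def inner_on_def)

lemma frob_norm_squared: "(frob_norm A)\<^sup>2 = tensor_inner A A"
  by (simp add: frob_norm_def tensor_inner_conv_inner_on inner_on_self_nonneg)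

lemma shape_frontal_slice: "shape P = ds @ [n] \<Longrightarrow> shape (frontal_slice P k) = ds"
  by (simp add: frontal_slice_def)

lemma entry_frontal_slice:
  "shape P = ds @ [n] \<Longrightarrow> is \<in> tensor_idx ds \<Longrightarrow> frontal_slice P k $\<^sub>t is = P $\<^sub>t (is @ [k])"
  by (simp add: frontal_slice_def entry_mk_tensor)

lemma orthonormal_frontal_slices_iff:
  assumes "shape P = ds @ [n]"
  shows "orthonormal_tensors (frontal_slices P) \<longleftrightarrow>
    orthonormal_on (tensor_idx ds) {..<n} (\<lambda>k is. P $\<^sub>t (is @ [k]))"
proof -
  have "tensor_inner (frontal_slices P ! i) (frontal_slices P ! j)
      = inner_on (tensor_idx ds) (\<lambda>is. P $\<^sub>t (is @ [i])) (\<lambda>is. P $\<^sub>t (is @ [j]))"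
    if "i < n" "j < n" for i j
    using that assms
    by (simp add: tensor_inner_conv_inner_on frontal_slices_def shape_frontal_slice)
       (rule inner_on_cong; rule entry_frontal_slice; simp)
  then show ?thesis
    using assms by (auto simp: orthonormal_tensors_def orthonormal_on_def frontal_slices_def)
qed

section \<open>Constraint and objective in terms of the slices\<close>

lemma shape_transpose_einstein:
  assumes "shape P = ds @ [m]" "shape Y = ds @ [n]"
  shows "shape (tensor_transpose P \<star>\<^bsub>length ds\<^esub> Y) = [m, n]"
  using assms by (simp add: einstein_def tensor_order_def tensor_transpose_def)

lemma entry_transpose_einstein:
  assumes "shape P = ds @ [m]" "shape Y = ds @ [n]" "i < m" "j < n"
  shows "(tensor_transpose P \<star>\<^bsub>length ds\<^esub> Y) $\<^sub>t [i, j]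
    = inner_on (tensor_idx ds) (\<lambda>is. P $\<^sub>t (is @ [i])) (\<lambda>is. Y $\<^sub>t (is @ [j]))"
  using assms
  by (auto simp: einstein_def Let_def tensor_order_def tensor_transpose_def entry_mk_tensor
      tensor_idx_pair Cons_in_tensor_idx inner_on_def intro!: sum.cong)

text \<open>The product is the Gram matrix of the frontal slices. Hence feasibility and the
  orthonormality demanded of the eigen-tensors are the same condition.\<close>

lemma transpose_einstein_eq_id_iff:
  assumes "shape P = ds @ [n]"
  shows "tensor_transpose P \<star>\<^bsub>length ds\<^esub> P = id_tensor n \<longleftrightarrow>
    orthonormal_on (tensor_idx ds) {..<n} (\<lambda>k is. P $\<^sub>t (is @ [k]))"
    (is "?E = _ \<longleftrightarrow> ?O")
proof
  have id: "id_tensor n $\<^sub>t [i, j] = (if i = j then 1 else 0)" if "i < n" "j < n" for i j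
    using that by (simp add: id_tensor_def entry_mk_tensor tensor_idx_pair)
  show ?O if "?E = id_tensor n"
    using entry_transpose_einstein[OF assms assms] id that by (simp add: orthonormal_on_def)
  show "?E = id_tensor n" if ?O
  proof (rule tensor_eqI)
    show "shape ?E = shape (id_tensor n)"
      using shape_transpose_einstein[OF assms assms] by (simp add: id_tensor_def)
    fix js assume "js \<in> tensor_idx (shape ?E)"
    then obtain i j where "i < n" "j < n" "js = [i, j]"
      using shape_transpose_einstein[OF assms assms] by (auto simp: tensor_idx_pair)
    then show "?E $\<^sub>t js = id_tensor n $\<^sub>t js"
      using entry_transpose_einstein[OF assms assms] id that by (simp add: orthonormal_on_def)
  qed
qed

lemma laplacian_entry:
  assumes "W \<in> carrier_mat n n" "i < n" "j < n"
  shows "laplacian W $$ (i, j) = (if i = j then (\<Sum>l<n. W $$ (i, l)) else 0) - W $$ (i, j)"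
  using assms by (simp add: laplacian_def degree_mat_def mat_diag_def)

text \<open>Expand the square: by symmetry of \<open>W\<close> both pure squares sum to the degree
  term \<open>D\<close>, and the mixed terms give \<open>- 2 * C\<close>. Half of the total is
  \<open>D - C\<close>.\<close>

lemma laplacian_quadratic_form:
  assumes W: "W \<in> carrier_mat n n" and sym: "transpose_mat W = W"
  shows "1 / 2 * (\<Sum>i<n. \<Sum>j<n. W $$ (i, j) * (y i - y j)\<^sup>2)
    = (\<Sum>i<n. \<Sum>j<n. laplacian W $$ (i, j) * y j * y i)"
proof -
  have symW: "W $$ (i, j) = W $$ (j, i)" if "i < n" "j < n" for i j
    using W sym that by (metis carrier_matD index_transpose_mat(1))
  define D where "D = (\<Sum>i<n. \<Sum>j<n. W $$ (i, j) * (y i)\<^sup>2)"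
  define C where "C = (\<Sum>i<n. \<Sum>j<n. W $$ (i, j) * y j * y i)"
  have "(\<Sum>i<n. \<Sum>j<n. W $$ (i, j) * (y j)\<^sup>2) = (\<Sum>i<n. \<Sum>j<n. W $$ (j, i) * (y j)\<^sup>2)"
    by (intro sum.cong refl) (simp add: symW)
  also have "\<dots> = D"
    unfolding D_def by (rule sum.swap)
  finally have D': "(\<Sum>i<n. \<Sum>j<n. W $$ (i, j) * (y j)\<^sup>2) = D" .
  have "(\<Sum>i<n. \<Sum>j<n. W $$ (i, j) * (y i - y j)\<^sup>2)
      = D + (\<Sum>i<n. \<Sum>j<n. W $$ (i, j) * (y j)\<^sup>2) - 2 * C"
    unfolding D_def C_def
    by (simp add: power2_diff algebra_simps sum.distrib sum_subtractf sum_distrib_left)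
  moreover have "(\<Sum>i<n. \<Sum>j<n. laplacian W $$ (i, j) * y j * y i) = D - C"
  proof -
    have "(\<Sum>j<n. laplacian W $$ (i, j) * y j * y i)
        = (\<Sum>j<n. W $$ (i, j) * (y i)\<^sup>2) - (\<Sum>j<n. W $$ (i, j) * y j * y i)" if "i < n" for i
    proof -
      have "(\<Sum>j<n. laplacian W $$ (i, j) * y j * y i)
          = (\<Sum>j<n. (if j = i then (\<Sum>l<n. W $$ (i, l)) * y i * y i else 0) - W $$ (i, j) * y j * y i)"
        using that by (intro sum.cong refl) (auto simp: laplacian_entry[OF W] left_diff_distrib)
      then show ?thesis
        using that by (simp add: sum_subtractf sum_distrib_right power2_eq_square mult.assoc)
    qed
    then show ?thesis by (simp add: D_def C_def sum_subtractf)
  qed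
  ultimately show ?thesis by (simp add: D')
qed

lemma shape_data_tensor:
  assumes "shape X = ds @ [n]" "L \<in> carrier_mat n n"
  shows "shape ((X \<times>\<^bsub>length ds + 1\<^esub> L) \<star>\<^bsub>1\<^esub> tensor_transpose X) = ds @ ds"
  using assms by (simp add: einstein_def Let_def mode_product_def tensor_order_def tensor_transpose_def)

text \<open>\<open>j\<close> is the summation index of the mode product, which acts on the left
  factor; \<open>i\<close> is the index contracted with the transpose.\<close>

lemma entry_data_tensor:
  assumes "shape X = ds @ [n]" "L \<in> carrier_mat n n" "s \<in> tensor_idx ds" "t \<in> tensor_idx ds"
  shows "((X \<times>\<^bsub>length ds + 1\<^esub> L) \<star>\<^bsub>1\<^esub> tensor_transpose X) $\<^sub>t (s @ t)
    = (\<Sum>i<n. \<Sum>j<n. L $$ (i, j) * X $\<^sub>t (s @ [j]) * X $\<^sub>t (t @ [i]))"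
  using assms length_tensor_idx[OF assms(3)]
  by (simp add: einstein_def Let_def mode_product_def tensor_order_def tensor_transpose_def entry_mk_tensor
      append_in_tensor_idx Cons_in_tensor_idx tensor_idx_Nil sum_tensor_idx_singleton sum_distrib_right
      nth_append list_update_append)

text \<open>\<open>y k\<close> is row \<open>k\<close> of the embedding, and squared distances of
  its columns split over \<open>k\<close>. Each row contributes one Laplacian form, and since
  \<open>y k i\<close> is linear in slice \<open>k\<close>, that form is the quadratic form of
  \<open>a\<close> at the slice.\<close>

lemma Phi_OLPP_eq_trace:
  assumes X: "shape X = ds @ [n]" and Q: "shape Q = ds @ [d]"
    and W: "W \<in> carrier_mat n n" and sym: "transpose_mat W = W"
    and a: "\<And>s t. s \<in> tensor_idx ds \<Longrightarrow> t \<in> tensor_idx ds \<Longrightarrow>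
      a s t = (\<Sum>i<n. \<Sum>j<n. laplacian W $$ (i, j) * X $\<^sub>t (s @ [j]) * X $\<^sub>t (t @ [i]))"
  shows "Phi_OLPP W (tensor_transpose Q \<star>\<^bsub>length ds\<^esub> X)
    = (\<Sum>k<d. inner_on (tensor_idx ds) (\<lambda>s. Q $\<^sub>t (s @ [k])) (apply_on (tensor_idx ds) a (\<lambda>s. Q $\<^sub>t (s @ [k]))))"
proof -
  let ?S = "tensor_idx ds" and ?Y = "tensor_transpose Q \<star>\<^bsub>length ds\<^esub> X" and ?q = "\<lambda>k s. Q $\<^sub>t (s @ [k])"
  let ?x = "\<lambda>i s. X $\<^sub>t (s @ [i])"
  define y where "y k i = inner_on ?S (?q k) (?x i)" for k i
  have Y: "shape ?Y = [d] @ [n]" using shape_transpose_einstein[OF Q X] by simp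
  have Phi: "Phi_OLPP W ?Y = (\<Sum>k<d. 1 / 2 * (\<Sum>i<n. \<Sum>j<n. W $$ (i, j) * (y k i - y k j)\<^sup>2))"
  proof -
    have "(frob_norm (frontal_slice ?Y i - frontal_slice ?Y j))\<^sup>2 = (\<Sum>k<d. (y k i - y k j)\<^sup>2)"
      if "i < n" "j < n" for i j
      using that unfolding frob_norm_squared tensor_inner_def
      by (simp add: minus_tensor_def shape_frontal_slice[OF Y] sum_tensor_idx_singleton entry_mk_tensor
          Cons_in_tensor_idx tensor_idx_Nil entry_frontal_slice[OF Y] entry_transpose_einstein[OF Q X]
          power2_eq_square flip: y_def)
    then have "Phi_OLPP W ?Y
        = 1 / 2 * (\<Sum>i<n. \<Sum>j<n. \<Sum>k<d. W $$ (i, j) * (y k i - y k j)\<^sup>2)"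
      using W by (simp add: Phi_OLPP_def sum_distrib_left)
    also have "(\<Sum>i<n. \<Sum>j<n. \<Sum>k<d. W $$ (i, j) * (y k i - y k j)\<^sup>2)
        = (\<Sum>i<n. \<Sum>k<d. \<Sum>j<n. W $$ (i, j) * (y k i - y k j)\<^sup>2)"
      by (intro sum.cong refl sum.swap)
    also have "\<dots> = (\<Sum>k<d. \<Sum>i<n. \<Sum>j<n. W $$ (i, j) * (y k i - y k j)\<^sup>2)"
      by (rule sum.swap)
    finally show ?thesis by (simp add: sum_distrib_left)
  qed
  have quad: "inner_on ?S (?q k) (apply_on ?S a (?q k))
      = (\<Sum>i<n. \<Sum>j<n. laplacian W $$ (i, j) * y k j * y k i)" for k
  proof -
    have "apply_on ?S a (?q k) s = (\<Sum>i<n. y k i * (\<Sum>j<n. laplacian W $$ (i, j) * ?x j s))"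
      if "s \<in> ?S" for s
    proof -
      have "apply_on ?S a (?q k) s
          = (\<Sum>t\<in>?S. \<Sum>i<n. (\<Sum>j<n. laplacian W $$ (i, j) * ?x j s) * ?x i t * ?q k t)"
        unfolding apply_on_def using that by (intro sum.cong refl) (simp add: a sum_distrib_right)
      also have "\<dots> = (\<Sum>i<n. \<Sum>t\<in>?S. (\<Sum>j<n. laplacian W $$ (i, j) * ?x j s) * ?x i t * ?q k t)"
        by (rule sum.swap)
      also have "\<dots> = (\<Sum>i<n. (\<Sum>j<n. laplacian W $$ (i, j) * ?x j s) * y k i)"
        unfolding y_def inner_on_def sum_distrib_left by (intro sum.cong refl) (simp add: mult_ac)
      finally show ?thesis by (simp add: mult.commute)
    qed
    then have "inner_on ?S (?q k) (apply_on ?S a (?q k))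
        = inner_on ?S (?q k) (\<lambda>s. \<Sum>i<n. y k i * (\<Sum>j<n. laplacian W $$ (i, j) * ?x j s))"
      by (intro inner_on_cong) auto
    also have "\<dots> = (\<Sum>i<n. y k i * (\<Sum>j<n. laplacian W $$ (i, j) * y k j))"
      unfolding inner_on_sum_right y_def ..
    finally show ?thesis by (simp add: sum_distrib_left mult_ac)
  qed
  show ?thesis unfolding Phi quad laplacian_quadratic_form[OF W sym] ..
qed

section \<open>Eigen-tensors and multiplicities\<close>

text \<open>Entries out of range vanish, so equality of tensors of shape \<open>ds\<close> is
  equality on \<open>tensor_idx ds\<close>; and \<open>ds @ ds\<close> determines \<open>ds\<close>
  by its length. This hands eigen-tensors over to \<open>apply_on\<close>.\<close>

lemma eigen_tensor_iff:
  assumes "shape A = ds @ ds"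
  shows "eigen_tensor A mu Z \<longleftrightarrow> shape Z = ds \<and> (\<exists>s\<in>tensor_idx ds. Z $\<^sub>t s \<noteq> 0) \<and>
    (\<forall>s\<in>tensor_idx ds. apply_on (tensor_idx ds) (\<lambda>s t. A $\<^sub>t (s @ t)) (entry Z) s = mu * Z $\<^sub>t s)"
proof (cases "shape Z = ds")
  case False
  have "ds @ ds \<noteq> shape Z @ shape Z"
  proof
    assume eq: "ds @ ds = shape Z @ shape Z"
    then have "length (ds @ ds) = length (shape Z @ shape Z)" by (rule arg_cong)
    then have "length ds = length (shape Z)" by simp
    with eq False show False by simp
  qed
  with False show ?thesis by (simp add: eigen_tensor_def assms)
next
  case True
  have "Z \<noteq> zero_tensor ds \<longleftrightarrow> (\<exists>s\<in>tensor_idx ds. Z $\<^sub>t s \<noteq> 0)"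
  proof
    assume "Z \<noteq> zero_tensor ds"
    then show "\<exists>s\<in>tensor_idx ds. Z $\<^sub>t s \<noteq> 0"
      using True by (metis entry_mk_tensor shape_mk_tensor tensor_eqI zero_tensor_def)
  next
    assume "\<exists>s\<in>tensor_idx ds. Z $\<^sub>t s \<noteq> 0"
    then show "Z \<noteq> zero_tensor ds" by (auto simp: zero_tensor_def entry_mk_tensor)
  qed
  moreover have "A \<star>\<^bsub>length ds\<^esub> Z = mu \<cdot>\<^sub>t Z \<longleftrightarrow>
    (\<forall>s\<in>tensor_idx ds. apply_on (tensor_idx ds) (\<lambda>s t. A $\<^sub>t (s @ t)) (entry Z) s = mu * Z $\<^sub>t s)"
    (is "?l = ?r \<longleftrightarrow> _")
  proof -
    have sh: "shape ?l = ds" "shape ?r = ds"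
      using True by (simp_all add: einstein_def Let_def tensor_order_def assms tensor_scale_def)
    have "?l $\<^sub>t s = apply_on (tensor_idx ds) (\<lambda>s t. A $\<^sub>t (s @ t)) (entry Z) s"
      "?r $\<^sub>t s = mu * Z $\<^sub>t s" if "s \<in> tensor_idx ds" for s
      using True that length_tensor_idx[OF that]
      by (simp_all add: einstein_def Let_def tensor_order_def assms tensor_scale_def entry_mk_tensor apply_on_def)
    then show ?thesis using sh by (metis tensor_eqI)
  qed
  ultimately show ?thesis using True by (simp add: eigen_tensor_def tensor_order_def assms)
qed

lemma orthonormal_on_independent:
  assumes "finite I" "orthonormal_on S I z" "\<And>s. s \<in> S \<Longrightarrow> (\<Sum>i\<in>I. c i * z i s) = 0" "i \<in> I"
  shows "c i = 0"
proof -
  have "0 = inner_on S (\<lambda>s. \<Sum>j\<in>I. c j * z j s) (z i)"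
    using assms(3) by (simp add: inner_on_def)
  also have "\<dots> = (\<Sum>j\<in>I. c j * inner_on S (z j) (z i))"
    by (rule inner_on_sum_left)
  also have "\<dots> = (\<Sum>j\<in>I. if j = i then c j else 0)"
    using assms(2,4) by (intro sum.cong refl) (auto simp: orthonormal_on_def)
  finally show ?thesis using assms(1,4) by simp
qed

text \<open>The basis vectors with eigenvalue \<open>mu\<close> are an independent family of this
  size. A larger one would have a nontrivial combination orthogonal to all of them; by symmetry of
  \<open>A\<close> it is also orthogonal to the other basis vectors, so Parseval makes it
  zero.\<close>

lemma eigen_multiplicity_eq_card:
  fixes lam :: "nat \<Rightarrow> real"
  assumes A: "shape A = ds @ ds"
    and sym: "\<forall>s\<in>tensor_idx ds. \<forall>t\<in>tensor_idx ds. A $\<^sub>t (s @ t) = A $\<^sub>t (t @ s)"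
    and N: "N = card (tensor_idx ds)"
    and u: "orthonormal_on (tensor_idx ds) {..<N} u"
    and eig: "\<And>i s. i < N \<Longrightarrow> s \<in> tensor_idx ds \<Longrightarrow>
      apply_on (tensor_idx ds) (\<lambda>s t. A $\<^sub>t (s @ t)) (u i) s = lam i * u i s"
  shows "eigen_multiplicity A mu = card {i. i < N \<and> lam i = mu}"
proof -
  let ?S = "tensor_idx ds" and ?K = "{i. i < N \<and> lam i = mu}"
  let ?a = "\<lambda>s t. A $\<^sub>t (s @ t)"
  let ?M = "{length Zs | Zs. lin_indep_tensors Zs \<and> (\<forall>Z\<in>set Zs. eigen_tensor A mu Z)}"
  have fin: "finite ?S" by (rule finite_tensor_idx)
  have upper: "length Zs \<le> card ?K"
    if ind: "lin_indep_tensors Zs" and Zs: "\<forall>Z\<in>set Zs. eigen_tensor A mu Z" for Zs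
  proof (rule ccontr)
    let ?l = "length Zs" and ?z = "\<lambda>j. entry (Zs ! j)"
    assume "\<not> ?l \<le> card ?K"
    then have "card ?K < card {..<?l}" by simp
    from homogeneous_system_nontrivial_solution[OF _ _ this, of "\<lambda>i j. inner_on ?S (?z j) (u i)"]
    obtain x j0 where j0: "j0 < ?l" "x j0 \<noteq> 0"
      and x: "\<And>i. i \<in> ?K \<Longrightarrow> (\<Sum>j<?l. inner_on ?S (?z j) (u i) * x j) = 0"
      by auto
    have Z: "shape (Zs ! j) = ds" "\<And>s. s \<in> ?S \<Longrightarrow> apply_on ?S ?a (?z j) s = mu * ?z j s" if "j < ?l" for j
      using Zs that eigen_tensor_iff[OF A] by (metis nth_mem)+
    have orth: "inner_on ?S (?z j) (u i) = 0" if "j < ?l" "i < N" "lam i \<noteq> mu" for i j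
    proof -
      have "mu * inner_on ?S (?z j) (u i) = inner_on ?S (apply_on ?S ?a (?z j)) (u i)"
        using Z(2)[OF that(1)] by (subst inner_on_linear(3)[symmetric]) (rule inner_on_cong; simp)
      also have "\<dots> = inner_on ?S (?z j) (apply_on ?S ?a (u i))"
        using sym by (intro inner_on_apply_on_symmetric) blast
      also have "\<dots> = lam i * inner_on ?S (?z j) (u i)"
        using eig[OF that(2)] by (subst inner_on_linear(6)[symmetric]) (rule inner_on_cong; simp)
      finally show ?thesis using that(3) by simp
    qed
    define v where "v = (\<lambda>s. \<Sum>j<?l. x j * ?z j s)"
    have "inner_on ?S v (u i) = 0" if "i < N" for i
    proof (cases "lam i = mu")
      case True
      then show ?thesis using x[of i] that by (simp add: v_def inner_on_sum_left mult.commute)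
    next
      case False
      then show ?thesis using orth that by (simp add: v_def inner_on_sum_left)
    qed
    then have "v s = 0" if "s \<in> ?S" for s
      using parseval(1)[OF fin _ u, of s v] that N by simp
    \<comment> \<open>\<open>lin_indep_tensors\<close> speaks of relations at all index lists, so
      those out of range have to be covered too.\<close>
    moreover have "v s = 0" if "s \<notin> ?S" for s
      using Z(1) that entry_outside by (auto simp: v_def intro!: sum.neutral)
    ultimately have "\<forall>s. (\<Sum>j<?l. x j * ?z j s) = 0" unfolding v_def by blast
    with ind j0 show False by (auto simp: lin_indep_tensors_def)
  qed
  have "card ?K \<in> ?M"
  proof -
    define ix where "ix = filter (\<lambda>i. lam i = mu) [0..<N]"
    define Zs where "Zs = map (\<lambda>i. mk_tensor ds (u i)) ix"
    have ix: "set ix = ?K" "distinct ix" by (auto simp: ix_def)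
    have len: "length Zs = card ?K"
      using distinct_card[OF ix(2)] ix(1) by (simp add: Zs_def)
    have ix_nth: "ix ! k < N" "lam (ix ! k) = mu" if "k < length ix" for k
      using ix(1) nth_mem[OF that] by auto
    have ent: "(Zs ! k) $\<^sub>t s = u (ix ! k) s" if "k < length ix" "s \<in> ?S" for k s
      using that by (simp add: Zs_def entry_mk_tensor)
    have orth: "orthonormal_on ?S {..<length ix} (\<lambda>k. u (ix ! k))"
      using u ix_nth ix(2) by (auto simp: orthonormal_on_def nth_eq_iff_index_eq)
    have l: "length Zs = length ix" by (simp add: Zs_def)
    have "lin_indep_tensors Zs"
      unfolding lin_indep_tensors_def l
    proof (intro allI impI)
      fix c :: "nat \<Rightarrow> real" and k
      assume 0: "\<forall>s. (\<Sum>k<length ix. c k * (Zs ! k) $\<^sub>t s) = 0" and k: "k < length ix"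
      have "(\<Sum>i<length ix. c i * u (ix ! i) s) = 0" if "s \<in> ?S" for s
      proof -
        have "(\<Sum>i<length ix. c i * u (ix ! i) s) = (\<Sum>i<length ix. c i * (Zs ! i) $\<^sub>t s)"
          using ent that by (intro sum.cong refl) simp
        then show ?thesis using 0 by simp
      qed
      then show "c k = 0"
        using k by (intro orthonormal_on_independent[where c = c and i = k, OF finite_lessThan orth]) auto
    qed
    moreover have "eigen_tensor A mu Z" if "Z \<in> set Zs" for Z
    proof -
      from that ix(1) obtain i where i: "i < N" "lam i = mu" and Zi: "Z = mk_tensor ds (u i)"
        by (auto simp: Zs_def)
      have "inner_on ?S (u i) (u i) \<noteq> 0" using u i by (simp add: orthonormal_on_def)
      then have "\<exists>s\<in>?S. u i s \<noteq> 0" using fin inner_on_self_eq_0_iff by blast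
      moreover have "apply_on ?S ?a (entry Z) s = mu * Z $\<^sub>t s" if "s \<in> ?S" for s
        using eig[OF i(1) that] i(2) that by (simp add: apply_on_def Zi entry_mk_tensor)
      ultimately show ?thesis by (auto simp: eigen_tensor_iff[OF A] Zi entry_mk_tensor)
    qed
    ultimately have "length Zs \<in> ?M" by blast
    then show ?thesis by (simp only: len)
  qed
  \<comment> \<open>Without finiteness \<open>Max\<close> would be unspecified.\<close>
  moreover have "finite ?M"
    by (rule finite_subset[of _ "{..card ?K}"]) (use upper in auto)
  ultimately show ?thesis
    unfolding eigen_multiplicity_def using upper by (intro Max_eqI) auto
qed

text \<open>A sorted list is determined by its multiset. This pins down the existential
  \<open>evs\<close> in \<open>smallest_eigen_tensors\<close>, whose first \<open>d\<close> entries
  become \<open>lam 0, ..., lam (d - 1)\<close>.\<close>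

lemma eigenvalue_list_iff:
  fixes lam :: "nat \<Rightarrow> real"
  assumes mult: "\<And>mu. eigen_multiplicity A mu = card {i. i < N \<and> lam i = mu}"
    and mono: "\<And>i j. i \<le> j \<Longrightarrow> j < N \<Longrightarrow> lam i \<le> lam j"
  shows "eigenvalue_list A evs \<longleftrightarrow> evs = map lam [0..<N]"
proof -
  have sorted: "sorted (map lam [0..<N])"
    using mono by (auto simp: sorted_iff_nth_mono)
  have count: "count (mset (map lam [0..<N])) mu = eigen_multiplicity A mu" for mu
  proof -
    have "count (mset (map lam [0..<N])) mu = length (filter (\<lambda>i. lam i = mu) [0..<N])"
      by (induction N) auto
    also have "\<dots> = card {i. i < N \<and> lam i = mu}"
      by (subst distinct_card[symmetric]) (auto intro: arg_cong[where f = card])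
    finally show ?thesis by (simp add: mult)
  qed
  show ?thesis
  proof
    assume ev: "eigenvalue_list A evs"
    then have "mset evs = mset (map lam [0..<N])"
      by (intro multiset_eqI) (simp add: eigenvalue_list_def count del: mset_map)
    then show "evs = map lam [0..<N]"
      using ev sorted properties_for_sort unfolding eigenvalue_list_def by metis
  qed (use sorted count in \<open>simp add: eigenvalue_list_def del: mset_map\<close>)
qed

theorem mainTheorem3:
  fixes Is :: "nat list" and M n d :: nat
    and X A :: tensor and W L :: "real mat"
  assumes "length Is = M"
    and "X \<in> tensor_space (Is @ [n])"
    and "W \<in> carrier_mat n n" and "transpose_mat W = W"
    and "L = laplacian W"
    and "1 \<le> d" and "d \<le> prod_list Is"
    and "A = (X \<times>\<^bsub>M + 1\<^esub> L) \<star>\<^bsub>1\<^esub> tensor_transpose X"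
  defines "feasible \<equiv> \<lambda>P. P \<in> tensor_space (Is @ [d]) \<and> tensor_transpose P \<star>\<^bsub>M\<^esub> P = id_tensor d"
    and "spectral \<equiv> \<lambda>P. P \<in> tensor_space (Is @ [d]) \<and>
      orthonormal_tensors (frontal_slices P) \<and> smallest_eigen_tensors A (frontal_slices P)"
  shows "A \<in> tensor_space (Is @ Is) \<and> symmetric_tensor A \<and>
    (\<exists>P. spectral P) \<and>
    (\<forall>P. spectral P \<longrightarrow>
      is_arg_min (\<lambda>Q. Phi_OLPP W (tensor_transpose Q \<star>\<^bsub>M\<^esub> X)) feasible P)"
proof -
  let ?S = "tensor_idx Is"
  define N where "N = card ?S"
  define a where "a = (\<lambda>s t. A $\<^sub>t (s @ t))"
  have fin: "finite ?S" by (rule finite_tensor_idx)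
  have X: "shape X = Is @ [n]" using assms(2) by (simp add: tensor_space_def)
  have L: "L \<in> carrier_mat n n"
    using assms(3) by (simp add: assms(5) laplacian_def minus_carrier_mat)
  have A: "shape A = Is @ Is"
    using shape_data_tensor[OF X L] by (simp add: assms(1,8))
  have a_eq: "a s t = (\<Sum>i<n. \<Sum>j<n. laplacian W $$ (i, j) * X $\<^sub>t (s @ [j]) * X $\<^sub>t (t @ [i]))"
    if "s \<in> ?S" "t \<in> ?S" for s t
    using entry_data_tensor[OF X L that] by (simp add: a_def assms(1,5,8))
  have L_sym: "laplacian W $$ (i, j) = laplacian W $$ (j, i)" if "i < n" "j < n" for i j
  proof -
    have "W $$ (i, j) = W $$ (j, i)"
      using assms(3,4) that by (metis carrier_matD index_transpose_mat(1))
    then show ?thesis using that by (auto simp: laplacian_entry[OF assms(3)])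
  qed
  \<comment> \<open>Exchanging the two sums transposes the Laplacian, which is symmetric because
    \<open>W\<close> is.\<close>
  have a_sym: "\<forall>s\<in>?S. \<forall>t\<in>?S. a s t = a t s"
  proof (intro ballI)
    fix s t assume st: "s \<in> ?S" "t \<in> ?S"
    have "a s t = (\<Sum>j<n. \<Sum>i<n. laplacian W $$ (i, j) * X $\<^sub>t (s @ [j]) * X $\<^sub>t (t @ [i]))"
      unfolding a_eq[OF st] by (rule sum.swap)
    also have "\<dots> = a t s"
      unfolding a_eq[OF st(2,1)] by (intro sum.cong refl) (simp add: L_sym)
    finally show "a s t = a t s" .
  qed
  obtain u lam where u: "orthonormal_on ?S {..<N} u"
    and eig: "\<And>i s. i < N \<Longrightarrow> s \<in> ?S \<Longrightarrow> apply_on ?S a (u i) s = lam i * u i s"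
    and mono: "\<And>i j. i \<le> j \<Longrightarrow> j < N \<Longrightarrow> lam i \<le> lam j"
    using spectral_theorem_sorted[OF fin a_sym] unfolding N_def by blast
  have mult: "eigen_multiplicity A mu = card {i. i < N \<and> lam i = mu}" for mu
    by (rule eigen_multiplicity_eq_card[OF A _ N_def u]) (use a_sym eig in \<open>auto simp: a_def\<close>)
  have evs: "eigenvalue_list A es \<longleftrightarrow> es = map lam [0..<N]" for es
    using mult mono by (rule eigenvalue_list_iff)
  note eigen_iff = eigen_tensor_iff[OF A, folded a_def]
  have dN: "d \<le> N" using assms(7) by (simp add: N_def card_tensor_idx)
  define q where "q = (\<lambda>P k s. P $\<^sub>t (s @ [k]))"
  have objective: "Phi_OLPP W (tensor_transpose Q \<star>\<^bsub>M\<^esub> X) = (\<Sum>k<d. inner_on ?S (q Q k) (apply_on ?S a (q Q k)))"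
    if "shape Q = Is @ [d]" for Q
    using Phi_OLPP_eq_trace[OF X that assms(3,4) a_eq] by (simp add: q_def assms(1))
  have feasible: "feasible P \<longleftrightarrow> shape P = Is @ [d] \<and> orthonormal_on ?S {..<d} (q P)" for P
    using transpose_einstein_eq_id_iff[of P Is d] by (auto simp: feasible_def tensor_space_def assms(1) q_def)
  have spectral: "spectral P \<longleftrightarrow> shape P = Is @ [d] \<and> orthonormal_on ?S {..<d} (q P) \<and>
    smallest_eigen_tensors A (frontal_slices P)" for P
    using orthonormal_frontal_slices_iff[of P Is d] by (auto simp: spectral_def tensor_space_def q_def)

  have "A \<in> tensor_space (Is @ Is)" using A by (simp add: tensor_space_def)
  moreover have "symmetric_tensor A"
    using A a_sym by (auto simp: symmetric_tensor_def a_def)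
  moreover have "\<exists>P. spectral P"
  proof
    \<comment> \<open>The last index selects the basis vector and the others its coordinate, so
      slice \<open>k\<close> is \<open>u k\<close> within the index range.\<close>
    define P where "P = mk_tensor (Is @ [d]) (\<lambda>is. u (last is) (butlast is))"
    have P: "shape P = Is @ [d]" by (simp add: P_def)
    have qP: "q P k s = u k s" if "s \<in> ?S" "k < d" for k s
      using that by (simp add: q_def P_def entry_mk_tensor snoc_in_tensor_idx)
    have inner: "inner_on ?S (q P i) (q P j) = inner_on ?S (u i) (u j)" if "i < d" "j < d" for i j
      using that by (intro inner_on_cong) (auto simp: qP)
    have orth: "orthonormal_on ?S {..<d} (q P)"
      using u dN by (auto simp: orthonormal_on_def inner)
    have len: "length (frontal_slices P) = d" by (simp add: frontal_slices_def P)
    have "eigen_tensor A (lam k) (frontal_slices P ! k)" if k: "k < d" for k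
    proof -
      have Z: "frontal_slices P ! k = frontal_slice P k" using k by (simp add: frontal_slices_def P)
      have ent: "frontal_slice P k $\<^sub>t s = u k s" if "s \<in> ?S" for s
        using entry_frontal_slice[OF P that] qP[OF that k] by (simp add: q_def)
      have "inner_on ?S (u k) (u k) \<noteq> 0" using u k dN by (simp add: orthonormal_on_def)
      then have "\<exists>s\<in>?S. u k s \<noteq> 0" using fin inner_on_self_eq_0_iff by blast
      moreover have "apply_on ?S a (entry (frontal_slice P k)) s = apply_on ?S a (u k) s" for s
        unfolding apply_on_def by (intro sum.cong refl) (simp add: ent)
      ultimately show ?thesis
        unfolding Z eigen_iff using eig k dN by (auto simp: ent shape_frontal_slice[OF P])
    qed
    then have "smallest_eigen_tensors A (frontal_slices P)"
      unfolding smallest_eigen_tensors_def evs len using dN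
      by (intro exI[of _ "map lam [0..<N]"] exI[of _ "map lam [0..<d]"]) (auto simp: take_map)
    then show "spectral P" using spectral P orth by blast
  qed
  moreover have "is_arg_min (\<lambda>Q. Phi_OLPP W (tensor_transpose Q \<star>\<^bsub>M\<^esub> X)) feasible P" if "spectral P" for P
  proof -
    have P: "shape P = Is @ [d]" and orth: "orthonormal_on ?S {..<d} (q P)"
      and small: "smallest_eigen_tensors A (frontal_slices P)"
      using that spectral by auto
    have len: "length (frontal_slices P) = d" by (simp add: frontal_slices_def P)
    \<comment> \<open>The slices need not be the vectors \<open>u k\<close>, and \<open>lams\<close>
      may come in any order. Knowing its multiset suffices, since only the sum enters the
      objective.\<close>
    obtain lams where lams: "length lams = d" "mset lams = mset (map lam [0..<d])"
      and eigP: "\<And>k. k < d \<Longrightarrow> eigen_tensor A (lams ! k) (frontal_slices P ! k)"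
      using small dN unfolding smallest_eigen_tensors_def evs len by (auto simp: take_map)
    have rayleigh: "inner_on ?S (q P k) (apply_on ?S a (q P k)) = lams ! k" if k: "k < d" for k
    proof -
      have Z: "frontal_slices P ! k = frontal_slice P k" using k by (simp add: frontal_slices_def P)
      have ent: "frontal_slice P k $\<^sub>t s = q P k s" if "s \<in> ?S" for s
        using entry_frontal_slice[OF P that] by (simp add: q_def)
      have "apply_on ?S a (q P k) s = apply_on ?S a (entry (frontal_slice P k)) s" for s
        unfolding apply_on_def by (intro sum.cong refl) (simp add: ent)
      then have "inner_on ?S (q P k) (apply_on ?S a (q P k)) = inner_on ?S (q P k) (\<lambda>s. lams ! k * q P k s)"
        using eigP[OF k] by (intro inner_on_cong refl) (simp add: Z eigen_iff ent)
      then show ?thesis using orth k by (simp add: inner_on_linear orthonormal_on_def)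
    qed
    have "Phi_OLPP W (tensor_transpose P \<star>\<^bsub>M\<^esub> X) = sum_list lams"
      by (simp add: objective[OF P] rayleigh sum_list_sum_nth lams(1) atLeast0LessThan)
    also have "\<dots> = sum_list (map lam [0..<d])"
      using lams(2) by (metis sum_mset_sum_list)
    also have "\<dots> = (\<Sum>i<d. lam i)"
      by (simp add: interv_sum_list_conv_sum_set_nat atLeast0LessThan)
    finally have opt: "Phi_OLPP W (tensor_transpose P \<star>\<^bsub>M\<^esub> X) = (\<Sum>i<d. lam i)" .
    have "(\<Sum>i<d. lam i) \<le> Phi_OLPP W (tensor_transpose Q \<star>\<^bsub>M\<^esub> X)" if Q: "feasible Q" for Q
    proof -
      have "(\<Sum>i<card {..<d}. lam i) \<le> (\<Sum>k<d. inner_on ?S (q Q k) (apply_on ?S a (q Q k)))"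
        using Q dN u eig mono unfolding feasible N_def by (intro ky_fan_minimum[OF fin]) auto
      then show ?thesis using Q by (simp add: feasible objective)
    qed
    then show ?thesis
      unfolding is_arg_min_def using feasible P orth opt by (auto simp: not_less)
  qed
  ultimately show ?thesis by blast
qed

end
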